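(* For every $w\in\Delta$ and every $\epsilon>0$, the open disc $B_\epsilon(w)$ of radius $\epsilon$ about $w$ contains some partition triangle $\Delta(a_0,\dots,a_n)$.
   Context: Let $\Delta=\{(x,y)\in\mathbb{R}^2: 1\ge x\ge y>0\}$. For each integer $k\ge 0$ let $\Delta_k=\{(x,y)\in\Delta: 1-x-ky\ge 0> 1-x-(k+1)y\}$, and let $T(\alpha,\beta)=\left(\frac{\beta}{\alpha},\frac{1-\alpha-k\beta}{\alpha}\right)$ for $(\alpha,\beta)\in\Delta_k$. A partition triangle is a set $\Delta(a_0,\dots,a_n)=\{(x,y)\in\Delta: T^k(x,y)\in\Delta_{a_k}\text{ for }0\le k\le n\}$ with $n\ge0$ and $a_0,\dots,a_n$ nonnegative integers. *)

theory Defs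
  imports "HOL-Analysis.Analysis"
begin

definition base_triangle :: "(real \<times> real) set" where
  "base_triangle = {(x, y). 1 \<ge> x \<and> x \<ge> y \<and> y > 0}"

definition cell :: "nat \<Rightarrow> (real \<times> real) set" where
  "cell k = {(x, y) \<in> base_triangle. 1 - x - real k * y \<ge> 0 \<and> 0 > 1 - x - real (k + 1) * y}"

(* The cells partition base_triangle, so the description below is proper there; the values of
   triangle_map outside base_triangle are irrelevant. *)
definition triangle_map :: "real \<times> real \<Rightarrow> real \<times> real" where
  "triangle_map = (\<lambda>(x, y). let k = (THE k. (x, y) \<in> cell k) in (y / x, (1 - x - real k * y) / x))"

(* T may map a point of base_triangle to a point with second coordinate 0, which lies outside
   base_triangle.  Requiring every iterate up to n to lie in a cell excludes such points and
   ensures that triangle_map is only ever applied inside base_triangle. *)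
definition partition_triangle :: "nat \<Rightarrow> (nat \<Rightarrow> nat) \<Rightarrow> (real \<times> real) set" where
  "partition_triangle n a =
     {p \<in> base_triangle. \<forall>k\<le>n. (triangle_map ^^ k) p \<in> cell (a k)}"

lemma cell_unique:
  assumes "p \<in> cell j" "p \<in> cell k"
  shows "j = k"
proof -
  obtain x y where p: "p = (x, y)" by (cases p)
  have y: "y > 0" using assms(1) by (auto simp: p cell_def base_triangle_def)
  have "real j * y < real (k + 1) * y" "real k * y < real (j + 1) * y"
    using assms by (auto simp: p cell_def)
  then have "real j < real (k + 1)" "real k < real (j + 1)"
    using y mult_less_cancel_right_pos by blast+
  then show ?thesis by linarith
qed

lemma base_triangle_eq_UN_cell: "base_triangle = (\<Union>k. cell k)"
proof
  show "(\<Union>k. cell k) \<subseteq> base_triangle" by (auto simp: cell_def)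
  show "base_triangle \<subseteq> (\<Union>k. cell k)"
  proof
    fix p assume p: "p \<in> base_triangle"
    obtain x y where xy: "p = (x, y)" by (cases p)
    have h: "x \<le> 1" "y > 0" using p by (auto simp: xy base_triangle_def)
    define k where "k = nat \<lfloor>(1 - x) / y\<rfloor>"
    have "0 \<le> (1 - x) / y" using h by simp
    then have "real k \<le> (1 - x) / y" "(1 - x) / y < real (k + 1)"
      unfolding k_def by linarith+
    then have "real k * y \<le> 1 - x" "1 - x < real (k + 1) * y"
      using h by (simp_all add: field_simps)
    then have "p \<in> cell k" using p by (simp add: xy cell_def)
    then show "p \<in> (\<Union>k. cell k)" by blast
  qed
qed

lemma triangle_map_cell:
  assumes "(x, y) \<in> cell k"
  shows "triangle_map (x, y) = (y / x, (1 - x - real k * y) / x)"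
proof -
  have "(THE j. (x, y) \<in> cell j) = k"
    using assms cell_unique by blast
  then show ?thesis by (simp add: triangle_map_def)
qed

end

theory Submission imports Defs begin

text \<open>The branch of \<open>T\<close> on each cell has a continuous inverse, so a small partition triangle near
  \<open>T w\<close> pulls back to one near \<open>w\<close>.  On a rational point the map acts like the Euclidean algorithm
  and reaches the bottom side \<open>y = 0\<close> after finitely many steps.  Near a point \<open>(u, 0)\<close> of the bottom
  side there are explicit small partition triangles: \<open>\<Delta>(N - j, j, 0, N)\<close> with \<open>j = \<lfloor>N u\<rfloor>\<close> and \<open>N\<close>
  large.  Rational points are dense.\<close>

definition triangle_limit :: "real \<times> real \<Rightarrow> bool" where
  "triangle_limit w \<longleftrightarrow> (\<forall>\<epsilon>>0. \<exists>n a. partition_triangle n a \<subseteq> ball w \<epsilon>)"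

text \<open>From u = y/x and v = (1 - x - ky)/x one gets 1/x = 1 + ku + v, and then y = ux.\<close>

definition inverse_branch :: "nat \<Rightarrow> real \<times> real \<Rightarrow> real \<times> real" where
  "inverse_branch k = (\<lambda>(u, v). (1 / (1 + real k * u + v), u / (1 + real k * u + v)))"

lemma dist_Pair_le: "dist (x, y) (u, v) \<le> \<bar>x - u\<bar> + \<bar>y - v\<bar>" for x y u v :: real
  using sqrt_sum_squares_le_sum_abs[of "x - u" "y - v"]
  by (simp add: dist_Pair_Pair dist_real_def)

text \<open>The value v = 0 is possible, so the image may leave \<open>base_triangle\<close>. The
  bounds on u and v keep the denominator 1 + ku + v of the inverse branch positive even
  there.\<close>

lemma triangle_map_cell_bounds:
  assumes "(x, y) \<in> cell k" "triangle_map (x, y) = (u, v)"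
  shows "0 < u" "u \<le> 1" "0 \<le> v" "v < u"
proof -
  have xy: "0 < y" "y \<le> x" "0 \<le> 1 - x - real k * y" "1 - x - real (k + 1) * y < 0"
    using assms(1) by (auto simp: cell_def base_triangle_def)
  have uv: "u = y / x" "v = (1 - x - real k * y) / x"
    using assms triangle_map_cell by auto
  show "0 < u" "u \<le> 1" "0 \<le> v" "v < u"
    using xy by (auto simp: uv algebra_simps intro!: divide_strict_right_mono)
qed

lemma inverse_branch_triangle_map:
  assumes "p \<in> cell k"
  shows "inverse_branch k (triangle_map p) = p"
proof -
  obtain x y where p: "p = (x, y)" by (cases p)
  have "0 < y" "y \<le> x"
    using assms by (auto simp: p cell_def base_triangle_def)
  then have "1 + real k * (y / x) + (1 - x - real k * y) / x = 1 / x" "x \<noteq> 0"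
    by (auto simp: field_simps)
  then show ?thesis
    using assms by (simp add: p triangle_map_cell inverse_branch_def)
qed

lemma isCont_inverse_branch:
  assumes "0 < u" "0 \<le> v"
  shows "isCont (inverse_branch k) (u, v)"
proof -
  have "0 \<le> real k * u" using assms by simp
  then have "1 + real k * u + v \<noteq> 0" using assms by linarith
  then show ?thesis
    unfolding inverse_branch_def case_prod_beta by (intro continuous_intros) auto
qed

text \<open>Here \<open>case_nat k a\<close> prepends the digit k to the sequence a, and the map
  acts on digit sequences as the shift.\<close>

lemma partition_triangle_SucD:
  assumes "p \<in> partition_triangle (Suc n) (case_nat k a)"
  shows "p \<in> cell k" "triangle_map p \<in> partition_triangle n a"
proof -
  have it: "(triangle_map ^^ i) p \<in> cell (case_nat k a i)" if "i \<le> Suc n" for i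
    using assms that by (simp add: partition_triangle_def)
  show "p \<in> cell k" using it[of 0] by simp
  have "(triangle_map ^^ i) (triangle_map p) \<in> cell (a i)" if "i \<le> n" for i
    using it[of "Suc i"] that by (simp add: funpow_swap1)
  \<comment> \<open>The next digit rules out that the image has second coordinate 0.\<close>
  moreover from this[of 0] have "triangle_map p \<in> base_triangle"
    by (auto simp: cell_def)
  ultimately show "triangle_map p \<in> partition_triangle n a"
    by (simp add: partition_triangle_def)
qed

text \<open>Prepending k to the digits of a triangle near T w gives points p with p and w the images
  of T p and T w under the same inverse branch. Continuity at the single point T w therefore
  suffices.\<close>

lemma triangle_limit_pullback:
  assumes w: "w \<in> cell k" and lim: "triangle_limit (triangle_map w)"
  shows "triangle_limit w"
  unfolding triangle_limit_def
proof (intro allI impI)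
  fix \<epsilon> :: real assume "\<epsilon> > 0"
  have "isCont (inverse_branch k) (triangle_map w)"
    using triangle_map_cell_bounds(1,3) isCont_inverse_branch w by (metis surj_pair)
  then obtain \<delta> where "\<delta> > 0"
    and \<delta>: "\<And>q. dist q (triangle_map w) < \<delta>
      \<Longrightarrow> dist (inverse_branch k q) (inverse_branch k (triangle_map w)) < \<epsilon>"
    using \<open>\<epsilon> > 0\<close> unfolding continuous_at_eps_delta by blast
  obtain n a where na: "partition_triangle n a \<subseteq> ball (triangle_map w) \<delta>"
    using lim \<open>\<delta> > 0\<close> unfolding triangle_limit_def by blast
  have "p \<in> ball w \<epsilon>" if "p \<in> partition_triangle (Suc n) (case_nat k a)" for p
    using partition_triangle_SucD[OF that] na \<delta>[of "triangle_map p"] w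
    by (auto simp: inverse_branch_triangle_map dist_commute)
  then show "\<exists>n a. partition_triangle n a \<subseteq> ball w \<epsilon>" by blast
qed

text \<open>The last digit N forces a small second coordinate, and the digit 0 before it turns this
  into x2 close to 1. Undoing the digits j and N - j then gives a point close to (j/N, 1/N), hence
  to (u, 0).\<close>

lemma triangle_limit_bottom_side:
  assumes u: "0 \<le> u" "u \<le> 1"
  shows "triangle_limit (u, 0)"
  unfolding triangle_limit_def
proof (intro allI impI)
  fix \<epsilon> :: real assume "\<epsilon> > 0"
  \<comment> \<open>The distance will be at most 7 / D with D at least N, so 10 leaves room.\<close>
  obtain N :: nat where N: "10 / \<epsilon> < real N" using reals_Archimedean2 by blast
  have "0 < 10 / \<epsilon>" using \<open>\<epsilon> > 0\<close> by simp
  then have "N > 0" using N by (cases N) auto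
  define j where "j = nat \<lfloor>real N * u\<rfloor>"
  have "0 \<le> real N * u" using u by simp
  then have j: "real j \<le> real N * u" "real N * u < real j + 1"
    unfolding j_def by linarith+
  have "real N * u \<le> real N" using u by (simp add: mult_left_le)
  then have jN: "j \<le> N" using j by linarith
  define a where "a = case_nat (N - j) (case_nat j (case_nat 0 (\<lambda>_. N)))"
  have "p \<in> ball (u, 0) \<epsilon>" if p: "p \<in> partition_triangle 3 a" for p
  proof -
    obtain x y where p_eq: "p = (x, y)" by (cases p)
    obtain x1 y1 where T1: "triangle_map p = (x1, y1)" by (cases "triangle_map p")
    obtain x2 y2 where T2: "triangle_map (x1, y1) = (x2, y2)" by (cases "triangle_map (x1, y1)")
    obtain x3 y3 where T3: "triangle_map (x2, y2) = (x3, y3)" by (cases "triangle_map (x2, y2)")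
    note D1 = partition_triangle_SucD[of p 2 "N - j" "case_nat j (case_nat 0 (\<lambda>_. N))"]
    note D2 = partition_triangle_SucD[of "(x1, y1)" 1 j "case_nat 0 (\<lambda>_. N)"]
    note D3 = partition_triangle_SucD[of "(x2, y2)" 0 0 "\<lambda>_. N"]
    have c0: "p \<in> cell (N - j)" and "(x1, y1) \<in> partition_triangle 2 (case_nat j (case_nat 0 (\<lambda>_. N)))"
      using D1 p by (auto simp: a_def T1 numeral_3_eq_3 numeral_2_eq_2)
    then have c1: "(x1, y1) \<in> cell j" and "(x2, y2) \<in> partition_triangle 1 (case_nat 0 (\<lambda>_. N))"
      using D2 by (auto simp: T2 numeral_2_eq_2)
    then have c2: "(x2, y2) \<in> cell 0" and "(x3, y3) \<in> partition_triangle 0 (\<lambda>_. N)"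
      using D3 by (auto simp: T3)
    then have c3: "(x3, y3) \<in> cell N"
      by (simp add: partition_triangle_def)
    have x2: "0 < x2" "x2 \<le> 1" "0 < y2" "y2 \<le> x2"
      using c2 by (auto simp: cell_def base_triangle_def)
    have y3: "y3 > 0" "real N * y3 \<le> 1"
      using c3 by (auto simp: cell_def base_triangle_def)
    \<comment> \<open>The gap 1 - x2 is at most y3, hence at most 1/N. This keeps the error j(1 -
      x2) bounded by 1 although j may be as large as N.\<close>
    have "y3 = (1 - x2) / x2" using T3 triangle_map_cell[OF c2] by simp
    then have "1 - x2 = x2 * y3" using x2 by simp
    also have "\<dots> \<le> y3" using x2 y3 by (simp add: mult_left_le_one_le)
    finally have "real N * (1 - x2) \<le> real N * y3" by (intro mult_left_mono) auto
    with y3 have "real N * (1 - x2) \<le> 1" by linarith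
    moreover have "real j * (1 - x2) \<le> real N * (1 - x2)"
      using jN x2 by (intro mult_right_mono) auto
    moreover have "0 \<le> real j * (1 - x2)" using x2 by simp
    ultimately have jx2: "0 \<le> real j * (1 - x2)" "real j * (1 - x2) \<le> 1" by linarith+
    \<comment> \<open>s is the denominator of the inverse branch with digit j at (x2, y2), and D / s
      is that of the branch with digit N - j at (x1, y1). The composition is thus (s / D, 1 / D),
      with s close to Nu and D close to N up to bounded errors.\<close>
    define s where "s = 1 + real j * x2 + y2"
    define D where "D = s + real (N - j) + x2"
    have s_eq: "s = 1 + real j - real j * (1 - x2) + y2" by (simp add: s_def algebra_simps)
    have s: "\<bar>s - real N * u\<bar> \<le> 3" "s > 0" using s_eq jx2 j x2 by linarith+
    \<comment> \<open>D - N equals 1 - j(1 - x2) + y2 + x2, which is positive because j(1 - x2) is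
      at most 1.\<close>
    have D: "\<bar>D - real N\<bar> \<le> 3" "D \<ge> real N"
      using s_eq jx2 x2 jN unfolding D_def of_nat_diff[OF jN] by linarith+
    have "D > 0" using D \<open>N > 0\<close> by linarith
    have "(x1, y1) = (1 / s, x2 / s)"
      using inverse_branch_triangle_map[OF c1] by (simp add: T2 inverse_branch_def s_def)
    moreover have "p = (1 / (1 + real (N - j) * x1 + y1), x1 / (1 + real (N - j) * x1 + y1))"
      using inverse_branch_triangle_map[OF c0] by (simp add: T1 inverse_branch_def)
    moreover have "1 + real (N - j) * (1 / s) + x2 / s = D / s"
      using s by (simp add: D_def field_simps)
    ultimately have pD: "p = (s / D, 1 / D)" using s by simp
    \<comment> \<open>Both s - Nu and D - N are bounded by 3 and u is at most 1, so the numerator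
      error is at most 6 independently of N.\<close>
    have "\<bar>s - u * D\<bar> = \<bar>(s - real N * u) - u * (D - real N)\<bar>"
      by (simp add: algebra_simps)
    also have "\<dots> \<le> \<bar>s - real N * u\<bar> + \<bar>u * (D - real N)\<bar>" by (rule abs_triangle_ineq4)
    also have "\<bar>u * (D - real N)\<bar> \<le> \<bar>D - real N\<bar>"
      using u by (simp add: abs_mult mult_left_le_one_le)
    finally have "\<bar>s - u * D\<bar> \<le> 6" using s D by linarith
    moreover have "\<bar>s / D - u\<bar> = \<bar>s - u * D\<bar> / D"
      using \<open>D > 0\<close> by (simp add: abs_if field_simps)
    ultimately have "\<bar>s / D - u\<bar> \<le> 6 / D"
      using \<open>D > 0\<close> by (simp add: divide_right_mono)
    moreover have "\<bar>1 / D - 0\<bar> = 1 / D" using \<open>D > 0\<close> by simp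
    ultimately have "dist p (u, 0) \<le> 6 / D + 1 / D"
      using dist_Pair_le[of "s / D" "1 / D" u 0] unfolding pD by linarith
    also have "\<dots> = 7 / D" by simp
    also have "\<dots> < 10 / D" using \<open>D > 0\<close> by (simp add: divide_strict_right_mono)
    also have "\<dots> \<le> 10 / real N" using D \<open>N > 0\<close> by (simp add: frac_le)
    also have "\<dots> < \<epsilon>" using N \<open>\<epsilon> > 0\<close> \<open>N > 0\<close> by (simp add: field_simps)
    finally show ?thesis by (simp add: dist_commute)
  qed
  then show "\<exists>n a. partition_triangle n a \<subseteq> ball (u, 0) \<epsilon>" by blast
qed

text \<open>Division with remainder c - a = kb + r shows that the map sends the triple (a, b, c) to
  (b, r, a). Since r < b, induction on b applies until r = 0, where the image lies on the bottom
  side.\<close>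

lemma triangle_limit_rational:
  fixes a b c :: nat
  assumes "0 < b" "b \<le> a" "a \<le> c"
  shows "triangle_limit (real a / real c, real b / real c)"
  using assms
proof (induction b arbitrary: a c rule: less_induct)
  case (less b)
  define k where "k = (c - a) div b"
  define r where "r = (c - a) mod b"
  have "r < b" using less.prems by (simp add: r_def)
  have "c - a = k * b + r" by (simp add: k_def r_def)
  then have "c = a + k * b + r" using less.prems by linarith
  then have c: "real c = real a + real k * real b + real r" by simp
  have pos: "real a > 0" "real b > 0" "real c > 0" using less.prems by auto
  let ?w = "(real a / real c, real b / real c)"
  \<comment> \<open>The signs of these two quantities place the point in \<open>cell k\<close>; the
    first is also the numerator of the second coordinate of its image.\<close>
  have e: "1 - real a / real c - real k * (real b / real c) = real r / real c"
    "1 - real a / real c - real (k + 1) * (real b / real c) = (real r - real b) / real c"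
  proof -
    have "1 - real a / real c - m * (real b / real c) = (real c - real a - m * real b) / real c" for m
      using pos by (simp add: diff_divide_distrib)
    moreover have "real c - real a - real k * real b = real r"
      "real c - real a - real (k + 1) * real b = real r - real b"
      by (simp_all add: c algebra_simps)
    ultimately show "1 - real a / real c - real k * (real b / real c) = real r / real c"
      "1 - real a / real c - real (k + 1) * (real b / real c) = (real r - real b) / real c"
      by metis+
  qed
  have "?w \<in> base_triangle"
    using less.prems pos by (simp add: base_triangle_def divide_right_mono)
  moreover have "(real r - real b) / real c < 0"
    using \<open>r < b\<close> pos by (simp add: divide_neg_pos)
  ultimately have w: "?w \<in> cell k"
    unfolding cell_def mem_Collect_eq prod.case e by simp
  have Tw: "triangle_map ?w = (real b / real a, real r / real a)"
    using triangle_map_cell[OF w] pos unfolding e by simp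
  have "triangle_limit (real b / real a, real r / real a)"
  proof (cases "r = 0")
    case True
    then show ?thesis
      using triangle_limit_bottom_side[of "real b / real a"] less.prems by simp
  next
    case False
    then show ?thesis using less.IH[of r b a] \<open>r < b\<close> less.prems by simp
  qed
  then show ?case using triangle_limit_pullback[OF w] Tw by simp
qed

theorem theorem20:
  fixes w :: "real \<times> real" and \<epsilon> :: real
  assumes "w \<in> base_triangle" and "\<epsilon> > 0"
  shows "\<exists>n a. partition_triangle n a \<subseteq> ball w \<epsilon>"
proof -
  obtain x y where w: "w = (x, y)" by (cases w)
  have xy: "0 < y" "y \<le> x" "x \<le> 1" using assms(1) by (auto simp: w base_triangle_def)
  obtain c :: nat where c: "4 / \<epsilon> < real c" using reals_Archimedean2 by blast
  have "0 < 4 / \<epsilon>" using assms(2) by simp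
  then have "c > 0" using c by (cases c) auto
  \<comment> \<open>Rounding up keeps b positive, and monotonicity of the ceiling preserves the
    order of b, a and c. Each coordinate moves by at most 1 / c, so c > 4 / \<epsilon> keeps the
    total below \<epsilon> / 2.\<close>
  define a where "a = nat \<lceil>real c * x\<rceil>"
  define b where "b = nat \<lceil>real c * y\<rceil>"
  have le: "0 < real c * y" "real c * y \<le> real c * x" "real c * x \<le> real c"
    using xy \<open>c > 0\<close> by (auto simp: mult_left_le)
  then have "0 < b" "b \<le> a" "a \<le> c"
    unfolding a_def b_def by linarith+
  then have "triangle_limit (real a / real c, real b / real c)"
    by (rule triangle_limit_rational)
  then obtain n f where nf: "partition_triangle n f \<subseteq> ball (real a / real c, real b / real c) (\<epsilon> / 2)"
    using assms(2) unfolding triangle_limit_def by (meson half_gt_zero)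
  have "\<bar>real a - real c * x\<bar> \<le> 1" "\<bar>real b - real c * y\<bar> \<le> 1"
    using le unfolding a_def b_def by linarith+
  then have "\<bar>real a / real c - x\<bar> \<le> 1 / real c" "\<bar>real b / real c - y\<bar> \<le> 1 / real c"
    using \<open>c > 0\<close> by (simp_all add: abs_le_iff field_simps)
  then have "dist (real a / real c, real b / real c) w \<le> 2 / real c"
    using dist_Pair_le[of "real a / real c" "real b / real c" x y] unfolding w by linarith
  also have "2 / real c < \<epsilon> / 2" using c assms(2) \<open>c > 0\<close> by (simp add: field_simps)
  finally have "dist (real a / real c, real b / real c) w < \<epsilon> / 2" .
  then have "ball (real a / real c, real b / real c) (\<epsilon> / 2) \<subseteq> ball w \<epsilon>"
    by (auto simp: subset_iff intro: dist_triangle_half_r)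
  with nf show ?thesis by blast
qed

end
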